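(* Let $k,m,r$ be positive integers with $r\le k-2$ and $k\le m$. Let $\mathcal S$ be the set of supports of the codewords of a binary constant weight code of length $m$, weight $k-2$ and minimum Hamming distance $4$ with $\alpha$ codewords (so $\alpha\le A(m,4,k-2)$). Let $\mathcal B_0$ be the multiset of $\left\lfloor\frac{k-1}{r}\right\rfloor{m\choose k-1}$ subsets of $[m]$ consisting of $\left\lfloor\frac{k-1}{r}\right\rfloor$ copies of each $(k-1)$-subset of $[m]$. Form $\mathcal B$ from $\mathcal B_0$ by, for each $S\in\mathcal S$, adding $S$ and removing one copy of each of the $m-k+2$ subsets of $[m]$ of size $k-1$ containing $S$. Write $\mathcal B=\{B_1,\dots,B_n\}$ and for $j\in[m]$ let $C_j=\{i\in[n]: j\in B_i\}$. Then $\{C_1,\dots,C_m\}$ is an $(n,N,k,m;r)$-MCBC with $$n=\left\lfloor\frac{k-1}{r}\right\rfloor{m\choose k-1}-\alpha(m-k+1)\quad\text{and}\quad N=n(k-1)-\alpha.$$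
   Context: An $(n,N,k,m;r)$ multiset combinatorial batch code (MCBC) is a collection $\mathcal C=\{C_1,\dots,C_m\}$ of subsets of $[n]=\{1,\dots,n\}$ (servers) with $N=\sum_{j=1}^m|C_j|$, such that for every multiset request $\{i_1,\dots,i_k\}$ of $k$ elements of $[n]$ in which every element has multiplicity at most $r$, there exist subsets $D_j\subseteq C_j$ with $|D_j|\le 1$ ($j\in[m]$) whose multiset union (the multiplicity of $i$ being $|\{j: i\in D_j\}|$) contains the request. $A(m,d,w)$ denotes the maximum number of codewords of a binary constant weight code of length $m$, weight $w$ and minimum Hamming distance $d$. *)

theory Defs
  imports Main "HOL-Library.Multiset"
begin

text \<open>Servers are the indices \<open>j \<in> {1..m}\<close>, items the elements of \<open>{1..n}\<close>; only the values of
  \<open>C\<close> on \<open>{1..m}\<close> matter. A request is a multiset \<open>R\<close> of \<open>k\<close> items, and the multiset union of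
  the sets \<open>D j\<close> is the sum of the multisets \<open>mset_set (D j)\<close>.\<close>

definition is_MCBC :: "nat \<Rightarrow> nat \<Rightarrow> nat \<Rightarrow> nat \<Rightarrow> nat \<Rightarrow> (nat \<Rightarrow> nat set) \<Rightarrow> bool" where
  "is_MCBC n N k m r C \<longleftrightarrow>
     (\<forall>j\<in>{1..m}. C j \<subseteq> {1..n}) \<and>
     N = (\<Sum>j=1..m. card (C j)) \<and>
     (\<forall>R :: nat multiset.
        size R = k \<and> set_mset R \<subseteq> {1..n} \<and> (\<forall>i. count R i \<le> r) \<longrightarrow>
        (\<exists>D. (\<forall>j\<in>{1..m}. D j \<subseteq> C j \<and> card (D j) \<le> 1) \<and>
             R \<subseteq># (\<Sum>j=1..m. mset_set (D j))))"

text \<open>Binary words of length \<open>m\<close> are boolean lists; list positions count from 0, while supports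
  are subsets of \<open>{1..m}\<close>.\<close>

definition support :: "bool list \<Rightarrow> nat set" where
  "support x = {j \<in> {1..length x}. x ! (j - 1)}"

definition weight :: "bool list \<Rightarrow> nat" where
  "weight x = card {i. i < length x \<and> x ! i}"

definition hamming_dist :: "bool list \<Rightarrow> bool list \<Rightarrow> nat" where
  "hamming_dist x y = card {i. i < length x \<and> x ! i \<noteq> y ! i}"

text \<open>As in the definition of \<open>A(m,d,w)\<close>, minimum distance \<open>d\<close> means that distinct codewords are
  at distance at least \<open>d\<close>; codes with fewer than two codewords are allowed.\<close>

definition constant_weight_code :: "nat \<Rightarrow> nat \<Rightarrow> nat \<Rightarrow> bool list set \<Rightarrow> bool" where
  "constant_weight_code m d w X \<longleftrightarrow>
     (\<forall>x\<in>X. length x = m \<and> weight x = w) \<and>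
     (\<forall>x\<in>X. \<forall>y\<in>X. x \<noteq> y \<longrightarrow> d \<le> hamming_dist x y)"

definition max_code_size :: "nat \<Rightarrow> nat \<Rightarrow> nat \<Rightarrow> nat" where
  "max_code_size m d w = Max {card X | X. constant_weight_code m d w X}"

text \<open>Here \<open>(k - 1) div r\<close> is the floor of the quotient.\<close>

definition initial_blocks :: "nat \<Rightarrow> nat \<Rightarrow> nat \<Rightarrow> nat set multiset" where
  "initial_blocks k m r =
     repeat_mset ((k - 1) div r) (mset_set {T. T \<subseteq> {1..m} \<and> card T = k - 1})"

text \<open>The sum counts a \<open>(k - 1)\<close>-set once for every \<open>S\<close> it contains, so one copy is removed
  for each such \<open>S\<close>.\<close>

definition modified_blocks :: "nat \<Rightarrow> nat \<Rightarrow> nat \<Rightarrow> nat set set \<Rightarrow> nat set multiset" where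
  "modified_blocks k m r \<S> =
     initial_blocks k m r + mset_set \<S>
       - (\<Sum>S\<in>\<S>. mset_set {T. T \<subseteq> {1..m} \<and> card T = k - 1 \<and> S \<subseteq> T})"

end

theory Submission
  imports Defs
begin

text \<open>
  By Hall's theorem a request can be served as soon as any subfamily of the requested items, with
  total multiplicity \<open>t\<close>, has blocks whose union has at least \<open>t\<close> elements. Two distinct supports
  differ in at least four places, so their union has at least \<open>k\<close> elements and every
  \<open>(k - 1)\<close>-set \<open>T\<close> contains at most one of them; hence replacing one copy of \<open>T\<close> by a support
  inside \<open>T\<close> keeps the number of blocks inside \<open>T\<close> equal to \<open>(k - 1) div r\<close>. Items whose blocks
  all lie in \<open>T\<close> therefore have total multiplicity at most \<open>k - 1\<close>. If the union has only
  \<open>k - 2\<close> elements, all blocks equal the same support, so there is a single item and its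
  multiplicity is at most \<open>r \<le> k - 2\<close>.
\<close>

section \<open>Systems of distinct representatives\<close>

text \<open>Induction on \<open>card I\<close>. If some nonempty proper subfamily \<open>J\<close>
  is tight, \<open>J\<close> and \<open>I - J\<close> are matched separately, the latter avoiding
  the union of \<open>J\<close>. Otherwise every nonempty proper subfamily has a spare element, so
  one index may take any of its elements.\<close>

theorem Hall_marriage:
  fixes A :: "'i \<Rightarrow> 'a set"
  assumes "finite I" and "\<And>i. i \<in> I \<Longrightarrow> finite (A i)"
    and "\<And>J. J \<subseteq> I \<Longrightarrow> card J \<le> card (\<Union>(A ` J))"
  shows "\<exists>f. inj_on f I \<and> (\<forall>i\<in>I. f i \<in> A i)"
  using assms
proof (induction "card I" arbitrary: I A rule: less_induct)
  case less
  note finI = less.prems(1) and finA = less.prems(2) and hall = less.prems(3)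
  show ?case
  proof (cases "\<exists>J. J \<subset> I \<and> J \<noteq> {} \<and> card (\<Union>(A ` J)) = card J")
    case True
    then obtain J where J: "J \<subset> I" "J \<noteq> {}" "card (\<Union>(A ` J)) = card J"
      by blast
    let ?U = "\<Union>(A ` J)"
    have finJ: "finite J"
      using J(1) finI by (auto intro: finite_subset)
    then have finU: "finite ?U"
      using J(1) finA by auto
    have "\<exists>f. inj_on f J \<and> (\<forall>i\<in>J. f i \<in> A i)"
    proof (rule less.hyps)
      show "card J < card I"
        using J(1) finI by (rule psubset_card_mono[rotated])
    qed (use J(1) finJ finA hall in auto)
    then obtain f where f: "inj_on f J" "\<And>i. i \<in> J \<Longrightarrow> f i \<in> A i"
      by blast
    have "\<exists>g. inj_on g (I - J) \<and> (\<forall>i\<in>I - J. g i \<in> A i - ?U)"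
    proof (rule less.hyps)
      have "I - J \<subset> I"
        using J by blast
      then show "card (I - J) < card I"
        using finI by (rule psubset_card_mono[rotated])
    next
      fix K assume K: "K \<subseteq> I - J"
      then have finK: "finite K"
        using finI by (auto intro: finite_subset)
      have fin: "finite (\<Union>i\<in>K. A i - ?U)"
        using K finK finA by auto
      \<comment> \<open>Hall's condition for the reduced sets on \<open>K\<close> is that for
        \<open>K\<close> together with \<open>J\<close>, minus the tight equation for
        \<open>J\<close>.\<close>
      have "card K + card J = card (K \<union> J)"
        using K finK finJ by (subst card_Un_disjoint) auto
      also have "\<dots> \<le> card (\<Union>(A ` (K \<union> J)))"
        using K J(1) by (intro hall) auto
      also have "\<Union>(A ` (K \<union> J)) = (\<Union>i\<in>K. A i - ?U) \<union> ?U"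
        by auto
      also have "card \<dots> = card (\<Union>i\<in>K. A i - ?U) + card J"
        unfolding J(3)[symmetric] using fin finU by (rule card_Un_disjoint) auto
      finally show "card K \<le> card (\<Union>i\<in>K. A i - ?U)"
        by simp
    qed (use finI finA in auto)
    then obtain g where g: "inj_on g (I - J)" "\<And>i. i \<in> I - J \<Longrightarrow> g i \<in> A i - ?U"
      by blast
    let ?h = "\<lambda>i. if i \<in> J then f i else g i"
    have "inj_on ?h I"
    proof (rule inj_onI)
      fix x y assume xy: "x \<in> I" "y \<in> I" "?h x = ?h y"
      show "x = y"
      proof (cases "x \<in> J \<longleftrightarrow> y \<in> J")
        case True
        then show ?thesis
          using xy inj_onD[OF f(1), of x y] inj_onD[OF g(1), of x y] by (cases "x \<in> J") auto
      next
        case False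
        then show ?thesis
          using xy f(2)[of x] f(2)[of y] g(2)[of x] g(2)[of y] by (cases "x \<in> J") auto
      qed
    qed
    then show ?thesis
      using f(2) g(2) by (intro exI[of _ ?h]) auto
  next
    case False
    show ?thesis
    proof (cases "I = {}")
      case False
      then obtain i where i: "i \<in> I"
        by blast
      have "card {i} \<le> card (\<Union>(A ` {i}))"
        using i by (intro hall) auto
      then obtain x where x: "x \<in> A i"
        by (cases "A i = {}") auto
      have "\<exists>g. inj_on g (I - {i}) \<and> (\<forall>j\<in>I - {i}. g j \<in> A j - {x})"
      proof (rule less.hyps)
        show "card (I - {i}) < card I"
          using finI i by (rule card_Diff1_less)
      next
        fix K assume K: "K \<subseteq> I - {i}"
        show "card K \<le> card (\<Union>j\<in>K. A j - {x})"
        proof (cases "K = {}")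
          case False
          \<comment> \<open>Without tight subfamilies the inequality is strict on \<open>K\<close>,
            which pays for the deletion of \<open>x\<close>.\<close>
          then have "card (\<Union>(A ` K)) \<noteq> card K"
            using K i \<open>\<not> (\<exists>J. J \<subset> I \<and> J \<noteq> {} \<and> card (\<Union>(A ` J)) = card J)\<close> by blast
          moreover have "card K \<le> card (\<Union>(A ` K))"
            using K by (intro hall) auto
          moreover have "card (\<Union>(A ` K)) - 1 \<le> card (\<Union>j\<in>K. A j - {x})"
            using diff_card_le_card_Diff[of "{x}" "\<Union>(A ` K)"] by simp
          ultimately show ?thesis
            by linarith
        qed simp
      qed (use finI finA in auto)
      then obtain g where g: "inj_on g (I - {i})" "\<And>j. j \<in> I - {i} \<Longrightarrow> g j \<in> A j - {x}"
        by blast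
      let ?h = "g(i := x)"
      have "inj_on ?h I"
      proof (rule inj_onI)
        fix y z assume "y \<in> I" "z \<in> I" "?h y = ?h z"
        then show "y = z"
          using g(2)[of y] g(2)[of z] inj_onD[OF g(1), of y z] by (auto split: if_splits)
      qed
      then show ?thesis
        using g(2) x by (intro exI[of _ ?h]) auto
    qed simp
  qed
qed

text \<open>Hall's theorem is applied to the individual copies \<open>(i, c)\<close> of requested
  items, where a copy of \<open>i\<close> may be fetched from any server in \<open>B i\<close>.
  Copies of one item have the same candidates, so testing sets of items with full multiplicity
  suffices.\<close>

lemma request_servable:
  fixes B C :: "nat \<Rightarrow> nat set" and R :: "nat multiset"
  assumes R: "set_mset R \<subseteq> {1..n}"
    and B: "\<And>i. i \<in> {1..n} \<Longrightarrow> B i \<subseteq> {1..m}"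
    and C: "\<And>j. j \<in> {1..m} \<Longrightarrow> C j = {i \<in> {1..n}. j \<in> B i}"
    and hall: "\<And>I. I \<subseteq> set_mset R \<Longrightarrow> (\<Sum>i\<in>I. count R i) \<le> card (\<Union>(B ` I))"
  shows "\<exists>D. (\<forall>j\<in>{1..m}. D j \<subseteq> C j \<and> card (D j) \<le> 1) \<and> R \<subseteq># (\<Sum>j=1..m. mset_set (D j))"
proof -
  let ?P = "SIGMA i:set_mset R. {..<count R i}"
  have finB: "finite (B i)" if "i \<in> set_mset R" for i
    using finite_subset[OF B] R that by blast
  have "\<exists>f. inj_on f ?P \<and> (\<forall>p\<in>?P. f p \<in> B (fst p))"
  proof (rule Hall_marriage)
    fix J assume J: "J \<subseteq> ?P"
    have finJ: "finite (fst ` J)"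
      by (rule finite_subset[of _ "set_mset R"]) (use J in auto)
    \<comment> \<open>Passing from \<open>J\<close> to all copies of the items it involves leaves
      the union of candidate servers unchanged.\<close>
    have "card J \<le> card (SIGMA i:fst ` J. {..<count R i})"
    proof (rule card_mono)
      show "J \<subseteq> (SIGMA i:fst ` J. {..<count R i})"
      proof
        fix p assume "p \<in> J"
        then show "p \<in> (SIGMA i:fst ` J. {..<count R i})"
          using subsetD[OF J, of p] by (cases p) (auto intro: rev_image_eqI)
      qed
    qed (use finJ in auto)
    also have "\<dots> = (\<Sum>i\<in>fst ` J. count R i)"
      using finJ by simp
    also have "\<dots> \<le> card (\<Union>(B ` fst ` J))"
      by (rule hall) (use J in auto)
    finally show "card J \<le> card (\<Union>p\<in>J. B (fst p))"
      by (simp add: image_image)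
  qed (use finB in auto)
  then obtain f where inj: "inj_on f ?P" and fB: "\<forall>p\<in>?P. f p \<in> B (fst p)"
    by blast
  have f: "f (i, c) \<in> B i" if "i \<in># R" "c < count R i" for i c
    using bspec[OF fB, of "(i, c)"] that by simp
  \<comment> \<open>\<open>D j\<close> holds the item whose copy \<open>f\<close> sends to server
    \<open>j\<close>; injectivity of \<open>f\<close> permits at most one.\<close>
  define D where "D j = {i \<in> set_mset R. \<exists>c<count R i. f (i, c) = j}" for j
  have fD: "finite (D j)" for j
    by (simp add: D_def)
  have "D j \<subseteq> C j \<and> card (D j) \<le> 1" if "j \<in> {1..m}" for j
  proof
    show "D j \<subseteq> C j"
      using f R C[OF that] by (auto simp: D_def)
    have "x = y" if xy: "x \<in> D j" "y \<in> D j" for x y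
    proof -
      obtain c d where "x \<in># R" "c < count R x" "y \<in># R" "d < count R y"
        "f (x, c) = j" "f (y, d) = j"
        using xy unfolding D_def by blast
      then show ?thesis
        using inj_onD[OF inj, of "(x, c)" "(y, d)"] by simp
    qed
    then show "card (D j) \<le> 1"
      by (simp add: card_le_Suc0_iff_eq fD)
  qed
  moreover have "R \<subseteq># (\<Sum>j=1..m. mset_set (D j))"
  proof (rule mset_subset_eqI)
    fix i
    show "count R i \<le> count (\<Sum>j=1..m. mset_set (D j)) i"
    proof (cases "i \<in># R")
      case True
      \<comment> \<open>The copies of \<open>i\<close> occupy distinct servers, each contributing
        one \<open>i\<close> to the multiset union.\<close>
      have "inj_on (\<lambda>c. f (i, c)) {..<count R i}"
        using inj True by (auto simp: inj_on_def)
      then have "count R i = card ((\<lambda>c. f (i, c)) ` {..<count R i})"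
        by (simp add: card_image)
      also have "\<dots> \<le> card {j \<in> {1..m}. i \<in> D j}"
      proof (rule card_mono)
        have "f (i, c) \<in> {1..m}" if "c < count R i" for c
          using f[OF True that] B[of i] R True by blast
        then show "(\<lambda>c. f (i, c)) ` {..<count R i} \<subseteq> {j \<in> {1..m}. i \<in> D j}"
          using True unfolding D_def by blast
      qed simp
      also have "\<dots> = (\<Sum>j=1..m. if i \<in> D j then 1 else 0)"
        by (simp add: sum.If_cases Int_def)
      also have "\<dots> = count (\<Sum>j=1..m. mset_set (D j)) i"
        by (simp add: count_sum count_mset_set' fD)
      finally show ?thesis .
    qed (simp add: not_in_iff)
  qed
  ultimately show ?thesis
    by blast
qed

section \<open>Constant weight codes\<close>

lemma finite_code:
  assumes "constant_weight_code m d w X"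
  shows "finite X"
  by (rule finite_subset[OF _ finite_lists_length_eq[of "UNIV :: bool set" m]])
    (use assms in \<open>auto simp: constant_weight_code_def\<close>)

text \<open>\<open>Max\<close> bounds its elements only over a finite set; finiteness comes from
  there being finitely many words of length \<open>m\<close>.\<close>

lemma card_le_max_code_size:
  assumes "constant_weight_code m d w X"
  shows "card X \<le> max_code_size m d w"
  unfolding max_code_size_def
proof (rule Max_ge)
  have "{card X |X. constant_weight_code m d w X} \<subseteq> card ` Pow {xs :: bool list. length xs = m}"
    by (auto simp: constant_weight_code_def)
  then show "finite {card X |X. constant_weight_code m d w X}"
    by (rule finite_subset) (use finite_lists_length_eq[of "UNIV :: bool set" m] in simp)
qed (use assms in blast)

text \<open>The shift between list positions from 0 and supports from 1 becomes an injective image,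
  which preserves cardinalities.\<close>

lemma support_eq_image: "support x = Suc ` {i. i < length x \<and> x ! i}"
proof -
  have "j \<in> Suc ` {i. i < length x \<and> x ! i}" if "j \<in> support x" for j
    using that by (intro image_eqI[of _ _ "j - 1"]) (auto simp: support_def)
  then show ?thesis
    by (auto simp: support_def)
qed

lemma card_support: "card (support x) = weight x"
  by (simp add: support_eq_image weight_def card_image)

lemma card_support_Diff:
  assumes "length x = length y"
  shows "card (support x - support y) + card (support y - support x) = hamming_dist x y"
proof -
  have "card (support x - support y) + card (support y - support x) =
      card ((support x - support y) \<union> (support y - support x))"
    by (rule card_Un_disjoint[symmetric]) (auto simp: support_def)
  also have "(support x - support y) \<union> (support y - support x) =
      Suc ` {i. i < length x \<and> x ! i \<noteq> y ! i}"
    using assms by (auto simp: support_eq_image)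
  finally show ?thesis
    by (simp add: hamming_dist_def card_image)
qed

lemma inj_on_support:
  assumes "\<And>x. x \<in> X \<Longrightarrow> length x = m"
  shows "inj_on support X"
proof (rule inj_onI)
  fix x y assume xy: "x \<in> X" "y \<in> X" "support x = support y"
  then have len: "length x = length y"
    by (simp add: assms)
  show "x = y"
  proof (rule nth_equalityI[OF len])
    fix i assume "i < length x"
    then have "x ! i \<longleftrightarrow> Suc i \<in> support x" "y ! i \<longleftrightarrow> Suc i \<in> support y"
      using len by (auto simp: support_def)
    then show "x ! i = y ! i"
      using xy by simp
  qed
qed

text \<open>The union has size \<open>w + card (S - S')\<close> and also
  \<open>w + card (S' - S)\<close>. The two differences together have at least 4 elements, so adding
  and halving gives the bound.\<close>

lemma card_support_Un_ge:
  assumes code: "constant_weight_code m 4 w X"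
    and S: "S \<in> support ` X" "S' \<in> support ` X" "S \<noteq> S'"
  shows "w + 2 \<le> card (S \<union> S')"
proof -
  obtain x y where xy: "x \<in> X" "y \<in> X" "x \<noteq> y" "S = support x" "S' = support y"
    using S by blast
  have fin: "finite S" "finite S'"
    using xy by (auto simp: support_def)
  have w: "card S = w" "card S' = w"
    using xy code by (auto simp: card_support constant_weight_code_def)
  have "4 \<le> card (S - S') + card (S' - S)"
    using xy code by (simp add: card_support_Diff constant_weight_code_def)
  moreover have "card (S \<union> S') = card S' + card (S - S')" "card (S' \<union> S) = card S + card (S' - S)"
    using fin card_Un_disjoint[of S' "S - S'"] card_Un_disjoint[of S "S' - S"]
    by (simp_all add: Un_commute)
  ultimately show ?thesis
    using w by (simp add: Un_commute)
qed

section \<open>Counting blocks\<close>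

text \<open>Such a \<open>T\<close> arises from \<open>S\<close> by inserting one element of
  \<open>A - S\<close>. For a support in \<open>{1..m}\<close> this yields the
  \<open>m - k + 2\<close> blocks that lose a copy.\<close>

lemma card_supersets_Suc:
  assumes "finite A" "S \<subseteq> A"
  shows "card {T. T \<subseteq> A \<and> card T = Suc (card S) \<and> S \<subseteq> T} = card A - card S"
proof -
  have finS: "finite S"
    using assms finite_subset by blast
  have "{T. T \<subseteq> A \<and> card T = Suc (card S) \<and> S \<subseteq> T} = (\<lambda>a. insert a S) ` (A - S)"
  proof (intro equalityI subsetI)
    fix T assume T: "T \<in> {T. T \<subseteq> A \<and> card T = Suc (card S) \<and> S \<subseteq> T}"
    then have "card (T - S) = 1"
      using finS by (simp add: card_Diff_subset)
    then obtain a where "T - S = {a}"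
      by (auto simp: card_1_singleton_iff)
    with T show "T \<in> (\<lambda>a. insert a S) ` (A - S)"
      by (intro image_eqI[of _ _ a]) auto
  qed (use assms finS in auto)
  moreover have "inj_on (\<lambda>a. insert a S) (A - S)"
    by (auto simp: inj_on_def)
  ultimately show ?thesis
    using assms finS by (simp add: card_image card_Diff_subset)
qed

lemma size_filter_image_mset_set:
  assumes "finite A"
  shows "size (filter_mset P (image_mset f (mset_set A))) = card {a \<in> A. P (f a)}"
  using assms by (simp add: filter_mset_image_mset)

lemma filter_mset_sum: "filter_mset P (\<Sum>x\<in>A. f x) = (\<Sum>x\<in>A. filter_mset P (f x))"
  by (induction A rule: infinite_finite_induct) simp_all

text \<open>Double counting of the pairs with \<open>j \<in> B i\<close>; it turns the sum of server
  sizes into the sum of block sizes.\<close>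

lemma card_incidences:
  assumes "finite A" "finite M"
  shows "(\<Sum>j\<in>M. card {i \<in> A. j \<in> B i}) = (\<Sum>i\<in>A. card (B i \<inter> M))"
proof -
  have "(\<Sum>j\<in>M. card {i \<in> A. j \<in> B i}) = (\<Sum>j\<in>M. \<Sum>i\<in>A. if j \<in> B i then 1 else 0)"
    using assms by (simp add: sum.If_cases Int_def)
  also have "\<dots> = (\<Sum>i\<in>A. \<Sum>j\<in>M. if j \<in> B i then 1 else 0)"
    by (rule sum.swap)
  also have "\<dots> = (\<Sum>i\<in>A. card (B i \<inter> M))"
    using assms by (simp add: sum.If_cases Int_def conj_commute)
  finally show ?thesis .
qed

text \<open>Multiset difference truncates, so it must be shown that every removed copy is present.
  The resulting additive equation lets all later counts avoid subtraction.\<close>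

lemma modified_blocks_balance:
  assumes "finite F" and size_F: "\<And>S. S \<in> F \<Longrightarrow> card S = k - 2"
    and "3 \<le> k" "0 < r" "r + 2 \<le> k"
    and sep: "\<And>S S'. S \<in> F \<Longrightarrow> S' \<in> F \<Longrightarrow> S \<noteq> S' \<Longrightarrow> k \<le> card (S \<union> S')"
  shows "modified_blocks k m r F +
      (\<Sum>S\<in>F. mset_set {T. T \<subseteq> {1..m} \<and> card T = k - 1 \<and> S \<subseteq> T}) =
    initial_blocks k m r + mset_set F"
proof -
  let ?E = "\<Sum>S\<in>F. mset_set {T. T \<subseteq> {1..m} \<and> card T = k - 1 \<and> S \<subseteq> T}"
  have "?E \<subseteq># initial_blocks k m r"
  proof (rule mset_subset_eqI)
    fix T
    have count_E: "count ?E T = card {S \<in> F. T \<subseteq> {1..m} \<and> card T = k - 1 \<and> S \<subseteq> T}"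
      using \<open>finite F\<close> by (simp add: count_sum count_mset_set' sum.If_cases Int_def)
    show "count ?E T \<le> count (initial_blocks k m r) T"
    proof (cases "T \<subseteq> {1..m} \<and> card T = k - 1")
      case True
      then have finT: "finite T"
        by (auto intro: finite_subset)
      \<comment> \<open>Two different supports inside \<open>T\<close> would force
        \<open>card T\<close> to be at least \<open>k\<close>, so at most one copy of
        \<open>T\<close> is removed.\<close>
      have "S = S'" if "S \<in> F" "S' \<in> F" "S \<subseteq> T" "S' \<subseteq> T" for S S'
      proof (rule ccontr)
        assume "S \<noteq> S'"
        then have "k \<le> card (S \<union> S')"
          using that by (intro sep)
        also have "\<dots> \<le> card T"
          using that finT by (intro card_mono) auto
        finally show False
          using True \<open>3 \<le> k\<close> by linarith
      qed
      then have "card {S \<in> F. S \<subseteq> T} \<le> 1"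
        using \<open>finite F\<close> by (auto simp: card_le_Suc0_iff_eq)
      \<comment> \<open>Since \<open>r \<le> k - 1\<close>, every \<open>T\<close> starts with at
        least one copy.\<close>
      also have "1 \<le> (k - 1) div r"
        using \<open>0 < r\<close> \<open>r + 2 \<le> k\<close> div_le_mono[of r "k - 1" r] by simp
      also have "\<dots> = count (initial_blocks k m r) T"
        using True by (simp add: initial_blocks_def)
      finally show ?thesis
        unfolding count_E using True by simp
    next
      case False
      then have E0: "{S \<in> F. T \<subseteq> {1..m} \<and> card T = k - 1 \<and> S \<subseteq> T} = {}"
        by blast
      show ?thesis
        unfolding count_E E0 by simp
    qed
  qed
  then have "?E \<subseteq># initial_blocks k m r + mset_set F"
    by (simp add: subset_mset.add_increasing2)
  then show ?thesis
    by (simp add: modified_blocks_def subset_mset.diff_add)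
qed

text \<open>\<open>B\<close> enumerates the blocks with repetition, so equal blocks belong to
  different items and \<open>n\<close> is forced to be the number of blocks. The formulas for
  \<open>n\<close> and \<open>N\<close> are stated over the integers to keep subtraction
  exact.\<close>

theorem theorem10:
  fixes k m r n \<alpha> :: nat
    and X :: "bool list set"
    and B C :: "nat \<Rightarrow> nat set"
  assumes "0 < k" and "0 < m" and "0 < r"
    and "r + 2 \<le> k" and "k \<le> m"
    and "constant_weight_code m 4 (k - 2) X"
    and "\<alpha> = card X"
    and "image_mset B (mset_set {1..n}) = modified_blocks k m r (support ` X)"
    and "\<And>j. j \<in> {1..m} \<Longrightarrow> C j = {i \<in> {1..n}. j \<in> B i}"
  shows "\<alpha> \<le> max_code_size m 4 (k - 2) \<and>
    int n = int ((k - 1) div r) * int (m choose (k - 1)) - int \<alpha> * (int m - int k + 1) \<and>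
    (\<exists>N. is_MCBC n N k m r C \<and> int N = int n * (int k - 1) - int \<alpha>)"
proof -
  note code = assms(6) and blocks = assms(8) and C = assms(9)
  define F where "F = support ` X"
  define q where "q = (k - 1) div r"
  define sup where "sup S = {T. T \<subseteq> {1..m} \<and> card T = k - 1 \<and> S \<subseteq> T}" for S
  define Q where "Q = {T. T \<subseteq> {1..m} \<and> card T = k - 1}"
  define E where "E = (\<Sum>S\<in>F. mset_set (sup S))"
  have k3: "3 \<le> k"
    using assms(3,4) by linarith
  have k1: "k - 1 = Suc (k - 2)"
    using k3 by linarith
  have len: "length x = m" "weight x = k - 2" if "x \<in> X" for x
    using code that by (auto simp: constant_weight_code_def)
  have finF: "finite F"
    using finite_code[OF code] by (simp add: F_def)
  have cardF: "card F = \<alpha>"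
    unfolding F_def assms(7) by (rule card_image, rule inj_on_support) (rule len)
  have F: "S \<subseteq> {1..m}" "card S = k - 2" if "S \<in> F" for S
    using that len by (auto simp: F_def card_support) (auto simp: support_def)
  have sep: "k \<le> card (S \<union> S')" if "S \<in> F" "S' \<in> F" "S \<noteq> S'" for S S'
    using card_support_Un_ge[OF code, of S S'] that k3 by (simp add: F_def)
  have finQ: "finite Q" "\<And>S. finite (sup S)"
    by (auto simp: Q_def sup_def)
  have cardQ: "card Q = m choose (k - 1)"
    unfolding Q_def by (subst n_subsets) auto
  have init: "initial_blocks k m r = repeat_mset q (mset_set Q)"
    by (simp add: initial_blocks_def q_def Q_def)
  have card_sup: "card (sup S) = m - k + 2" if "S \<in> F" for S
  proof -
    have "card (sup S) = m - (k - 2)"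
      using card_supersets_Suc[of "{1..m}" S] F[OF that] unfolding sup_def k1 by simp
    then show ?thesis
      using k3 \<open>k \<le> m\<close> by linarith
  qed
  \<comment> \<open>With \<open>E\<close> collecting all removed copies, the numerical facts below
    come from applying size, sum of cardinalities, filtering or \<open>count\<close> to both
    sides.\<close>
  have balance: "image_mset B (mset_set {1..n}) + E = repeat_mset q (mset_set Q) + mset_set F"
    using modified_blocks_balance[OF finF F(2) k3 assms(3,4) sep, of m]
    unfolding blocks init E_def sup_def F_def .

  have size_eq: "n + size E = q * card Q + card F"
    using arg_cong[OF balance, of size] by simp
  moreover have "size E = \<alpha> * (m - k + 2)"
    by (simp add: E_def card_sup cardF)
  ultimately have n_eq: "n + \<alpha> * (m - k + 2) = q * (m choose (k - 1)) + \<alpha>"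
    by (simp add: cardQ cardF)

  have block: "B i \<subseteq> {1..m} \<and> (card (B i) = k - 1 \<or> B i \<in> F)" if "i \<in> {1..n}" for i
  proof -
    have "B i \<in># image_mset B (mset_set {1..n}) + E"
      using that by simp
    then have "0 < count (repeat_mset q (mset_set Q) + mset_set F) (B i)"
      unfolding balance count_greater_zero_iff .
    then have "B i \<in> Q \<or> B i \<in> F"
      by (auto simp: count_mset_set' split: if_splits)
    then show ?thesis
      using F by (auto simp: Q_def)
  qed

  have sumE: "(\<Sum>T\<in>#E. card T) = (k - 1) * size E"
  proof -
    have "T \<in># E \<Longrightarrow> card T = k - 1" for T
      using finQ finF by (auto simp: E_def set_mset_sum sup_def)
    then have "image_mset card E = image_mset (\<lambda>_. k - 1) E"
      by (rule image_mset_cong)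
    then show ?thesis
      by simp
  qed
  have "(\<Sum>i=1..n. card (B i)) + (k - 1) * size E = q * (card Q * (k - 1)) + card F * (k - 2)"
  proof -
    have "(\<Sum>T\<in>#image_mset B (mset_set {1..n}) + E. card T) =
        (\<Sum>i=1..n. card (B i)) + (k - 1) * size E"
      unfolding sum_unfold_sum_mset by (simp add: sumE image_mset.compositionality comp_def)
    moreover have "(\<Sum>T\<in>#repeat_mset q (mset_set Q) + mset_set F. card T) =
        q * (\<Sum>T\<in>Q. card T) + (\<Sum>T\<in>F. card T)"
      unfolding sum_unfold_sum_mset by (induction q) simp_all
    moreover have "(\<Sum>T\<in>Q. card T) = card Q * (k - 1)" "(\<Sum>T\<in>F. card T) = card F * (k - 2)"
      by (simp_all add: Q_def F(2))
    ultimately show ?thesis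
      unfolding balance by simp
  qed
  \<comment> \<open>If all blocks had \<open>k - 1\<close> elements the sum would be
    \<open>n * (k - 1)\<close>; comparison shows that each support accounts for a deficit of
    one.\<close>
  moreover have "n * (k - 1) + (k - 1) * size E = q * (card Q * (k - 1)) + card F * (k - 1)"
    using arg_cong[OF size_eq, of "\<lambda>x. x * (k - 1)"] by (simp add: algebra_simps)
  moreover have "card F * (k - 1) = card F * (k - 2) + card F"
    unfolding k1 by simp
  ultimately have sum_card: "(\<Sum>i=1..n. card (B i)) + \<alpha> = n * (k - 1)"
    using cardF by linarith

  \<comment> \<open>Both sides of \<open>balance\<close> are restricted to subsets of
    \<open>T\<close>. The only \<open>(k - 1)\<close>-set inside \<open>T\<close> is
    \<open>T\<close> itself, so \<open>E\<close> contributes one copy per support inside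
    \<open>T\<close>; these cancel against the supports added on the right, leaving
    \<open>q\<close>.\<close>
  have inside: "card {i \<in> {1..n}. B i \<subseteq> T} = q" if T: "T \<subseteq> {1..m}" "card T = k - 1" for T
  proof -
    have finT: "finite T"
      using T by (auto intro: finite_subset)
    have eqT: "T' = T" if "T' \<subseteq> T" "card T' = k - 1" for T'
      using that T finT by (simp add: card_subset_eq)
    have "size (filter_mset (\<lambda>Y. Y \<subseteq> T) E) = (\<Sum>S\<in>F. card {T' \<in> sup S. T' \<subseteq> T})"
      using finQ by (simp add: E_def filter_mset_sum)
    also have "\<dots> = (\<Sum>S\<in>F. if S \<subseteq> T then 1 else 0)"
    proof (rule sum.cong[OF refl])
      fix S
      have "{T' \<in> sup S. T' \<subseteq> T} = (if S \<subseteq> T then {T} else {})"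
        using T eqT by (auto simp: sup_def)
      then show "card {T' \<in> sup S. T' \<subseteq> T} = (if S \<subseteq> T then 1 else 0)"
        by simp
    qed
    also have "\<dots> = card {S \<in> F. S \<subseteq> T}"
      using finF by (simp add: sum.If_cases Int_def)
    finally have "size (filter_mset (\<lambda>Y. Y \<subseteq> T) E) = card {S \<in> F. S \<subseteq> T}" .
    moreover have "{Y \<in> Q. Y \<subseteq> T} = {T}"
      using T eqT by (auto simp: Q_def)
    then have "size (filter_mset (\<lambda>Y. Y \<subseteq> T) (repeat_mset q (mset_set Q))) = q"
      using finQ by (induction q) simp_all
    ultimately show ?thesis
      using arg_cong[OF balance, of "\<lambda>M. size (filter_mset (\<lambda>Y. Y \<subseteq> T) M)"] finF
      by (simp add: size_filter_image_mset_set del: image_mset_mset_set)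
  qed

  \<comment> \<open>A block of size \<open>k - 2\<close> is not in \<open>Q\<close>, and
    \<open>mset_set F\<close> contains it at most once.\<close>
  have distinct_short: "i = i'"
    if "i \<in> {1..n}" "i' \<in> {1..n}" "B i = B i'" "card (B i) = k - 2" for i i'
  proof -
    have "card {a \<in> {1..n}. B a = B i} = count (image_mset B (mset_set {1..n})) (B i)"
      using size_filter_image_mset_set[of "{1..n}" "\<lambda>Y. Y = B i" B]
      by (simp add: filter_eq_replicate_mset)
    also have "\<dots> \<le> count (repeat_mset q (mset_set Q) + mset_set F) (B i)"
      unfolding balance[symmetric] by simp
    also have "\<dots> \<le> 1"
      using that(4) k3 by (auto simp: count_mset_set' Q_def)
    finally show ?thesis
      using that by (auto simp: card_le_Suc0_iff_eq)
  qed

  have serve: "\<exists>D. (\<forall>j\<in>{1..m}. D j \<subseteq> C j \<and> card (D j) \<le> 1) \<and> R \<subseteq># (\<Sum>j=1..m. mset_set (D j))"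
    if R: "size R = k" "set_mset R \<subseteq> {1..n}" "\<And>i. count R i \<le> r" for R
  proof (rule request_servable[OF R(2) _ C])
    fix I assume I: "I \<subseteq> set_mset R"
    let ?U = "\<Union>(B ` I)" and ?t = "\<Sum>i\<in>I. count R i"
    have finI: "finite I"
      using I by (auto intro: finite_subset)
    have In: "I \<subseteq> {1..n}"
      using I R(2) by blast
    have U: "?U \<subseteq> {1..m}"
      using block In by blast
    then have finU: "finite ?U"
      by (rule finite_subset) simp
    have t_le_k: "?t \<le> k"
      using I sum_mono2[OF _ I, of "count R"] R(1) by (simp add: size_multiset_overloaded_eq)
    have t_le: "?t \<le> card I * r"
      using sum_bounded_above[of I "count R" r] R(3) by simp
    have card_B: "k - 2 \<le> card (B i)" "card (B i) \<le> card ?U" if "i \<in> I" for i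
    proof -
      have "card (B i) = k - 1 \<or> card (B i) = k - 2"
        using block[of i] F(2)[of "B i"] In that by blast
      then show "k - 2 \<le> card (B i)"
        by linarith
      show "card (B i) \<le> card ?U"
        using that by (intro card_mono finU) auto
    qed
    \<comment> \<open>A nonempty \<open>I\<close> has a union of size at least that of one block,
      hence at least \<open>k - 2\<close>.\<close>
    consider "I = {}" | "k \<le> card ?U" | "I \<noteq> {}" "card ?U = k - 1" | "I \<noteq> {}" "card ?U = k - 2"
      using card_B by fastforce
    then show "?t \<le> card ?U"
    proof cases
      case 3
      \<comment> \<open>At most \<open>q\<close> items have their blocks inside the union, each
        requested at most \<open>r\<close> times, and \<open>q * r \<le> k - 1\<close>.\<close>
      have "card I \<le> card {i \<in> {1..n}. B i \<subseteq> ?U}"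
        using In by (intro card_mono) auto
      also have "\<dots> = q"
        using U 3 by (intro inside)
      finally have "card I * r \<le> q * r"
        by simp
      also have "\<dots> \<le> k - 1"
        by (simp add: q_def)
      finally show ?thesis
        using t_le 3 by linarith
    next
      case 4
      \<comment> \<open>Each block already fills the union, so all blocks coincide and
        \<open>distinct_short\<close> leaves a single item, requested at most
        \<open>r \<le> k - 2\<close> times.\<close>
      have "B i = ?U" if "i \<in> I" for i
        using card_B[OF that] 4 finU that by (intro card_subset_eq) auto
      then have "x = y" if "x \<in> I" "y \<in> I" for x y
        using distinct_short[of x y] In that 4 by (metis subsetD)
      then have "card I \<le> 1"
        using finI by (simp add: card_le_Suc0_iff_eq)
      then have "card I * r \<le> 1 * r"
        by (rule mult_le_mono1)
      then show ?thesis
        using t_le assms(4) 4 by linarith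
    qed (use t_le_k in auto)
  qed (use block in auto)

  let ?N = "\<Sum>j=1..m. card (C j)"
  have "?N = (\<Sum>j=1..m. card {i \<in> {1..n}. j \<in> B i})"
    by (intro sum.cong arg_cong[of _ _ card] C) auto
  also have "\<dots> = (\<Sum>i=1..n. card (B i \<inter> {1..m}))"
    by (rule card_incidences) auto
  also have "\<dots> = (\<Sum>i=1..n. card (B i))"
    using block by (intro sum.cong refl) (simp add: Int_absorb2)
  finally have N: "?N + \<alpha> = n * (k - 1)"
    using sum_card by simp
  have "is_MCBC n ?N k m r C"
    unfolding is_MCBC_def using serve C by auto
  moreover have "int ?N = int n * (int k - 1) - int \<alpha>"
    using arg_cong[OF N, of int] \<open>0 < k\<close> by (simp add: of_nat_diff)
  moreover have "\<alpha> \<le> max_code_size m 4 (k - 2)"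
    using card_le_max_code_size[OF code] assms(7) by simp
  \<comment> \<open>Each support adds one block and removes \<open>m - k + 2\<close>, a net loss of
    \<open>m - k + 1\<close>; \<open>k \<le> m\<close> makes the passage to integers exact.\<close>
  moreover have "int n = int q * int (m choose (k - 1)) - int \<alpha> * (int m - int k + 1)"
  proof -
    have "int (m - k + 2) = int m - int k + 2"
      using \<open>k \<le> m\<close> by linarith
    then have "int n + int \<alpha> * (int m - int k + 2) = int q * int (m choose (k - 1)) + int \<alpha>"
      using arg_cong[OF n_eq, of int] by (simp only: of_nat_add of_nat_mult)
    then show ?thesis
      by (simp add: algebra_simps)
  qed
  ultimately show ?thesis
    unfolding q_def by blast
qed

end
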